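(* Let $Z=((\bar Y_n)_n,(\bar Y'_n)_n)$ be a couple of independent sequences of independent standard Gaussian random variables. For $(a_n)_{n\ge0}\in\ell^2$ define $$x_t=a_0\bar Y'_0+\sqrt2\sum_{k=1}^{\infty}a_k\big(\bar Y_k\sin(2k\pi t)+\bar Y'_k\cos(2k\pi t)\big),\qquad t\in[0,1],$$ the limit being in mean square and uniform in $t$. Then $$\|x_t\|_{\mathscr{H}}=\sqrt{a_0^2+2\sum_{n\ge1}a_n^2},$$ and hence an isometry between $\mathscr{H}_Z$ and $\ell^2$ is naturally defined.
   Context: $\mathscr{H}$ denotes the set of real Gaussian stochastic processes $\{x_t\}_{t\in[0,1]}$ such that: $E(x_t)=0$ for all $t$; the process is continuously stationary, i.e. its covariance function $C(s,t)=\mathrm{Cov}(x_s,x_t)$ satisfies $C(s,t)=\tilde C(s-t)$ for all $s,t$ for some real continuous function $\tilde C$; and the process is periodical, i.e. $x_0=x_1$ almost surely. The inner product used is $(\{x_t\}_{t\in[0,1]},\{y_t\}_{t\in[0,1]})=\int_0^1E(x_ty_t)\,dt$, and $\|x_t\|_{\mathscr{H}}$ denotes the corresponding norm of the process $\{x_t\}_{t\in[0,1]}$, i.e. $\big(\int_0^1E(x_t^2)\,dt\big)^{1/2}$. For $Z=((\bar Y_n)_n,(\bar Y'_n)_n)$, $$\mathscr{H}_Z=\Big\{\{x_t\}_{t\in[0,1]}\in\mathscr{H}:\ x_t=a_0\bar Y'_0+\sqrt2\sum_{k=1}^{\infty}a_k\big(\bar Y_k\sin(2k\pi t)+\bar Y'_k\cos(2k\pi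 t)\big),\ (a_n)_n\in\ell^2\Big\},$$ where the limit is in mean square and uniform in $t$. Here $\ell^2$ is the space of real square-summable sequences $(a_n)_{n\ge0}$, with its usual norm $\|(a_n)_n\|=\big(\sum_{n\ge0}a_n^2\big)^{1/2}$. *)

theory Defs
  imports "HOL-Probability.Probability"
begin

definition square_integrable :: "'a measure \<Rightarrow> ('a \<Rightarrow> real) \<Rightarrow> bool" where
  "square_integrable M X \<longleftrightarrow> X \<in> borel_measurable M \<and> integrable M (\<lambda>\<omega>. (X \<omega>)\<^sup>2)"

definition covar :: "'a measure \<Rightarrow> ('a \<Rightarrow> real) \<Rightarrow> ('a \<Rightarrow> real) \<Rightarrow> real" where
  "covar M X Y =
     (LINT \<omega>|M. (X \<omega> - (LINT \<omega>'|M. X \<omega>')) * (Y \<omega> - (LINT \<omega>'|M. Y \<omega>')))"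

text \<open>As usual for Gaussian processes, almost surely constant variables count as
  (degenerate) Gaussian variables.\<close>

definition gaussian_rv :: "'a measure \<Rightarrow> ('a \<Rightarrow> real) \<Rightarrow> bool" where
  "gaussian_rv M X \<longleftrightarrow>
     X \<in> borel_measurable M \<and>
     ((\<exists>\<mu>. AE \<omega> in M. X \<omega> = \<mu>) \<or>
      (\<exists>\<mu> \<sigma>. \<sigma> > 0 \<and> distributed M lborel X (normal_density \<mu> \<sigma>)))"

text \<open>A process indexed by \<open>[0,1]\<close> is a function \<open>x :: real \<Rightarrow> 'a \<Rightarrow> real\<close>;
  its values at times outside \<open>{0..1}\<close> are never used.\<close>

definition gaussian_process :: "'a measure \<Rightarrow> (real \<Rightarrow> 'a \<Rightarrow> real) \<Rightarrow> bool" where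
  "gaussian_process M x \<longleftrightarrow>
     (\<forall>T c. finite T \<and> T \<subseteq> {0..1} \<longrightarrow> gaussian_rv M (\<lambda>\<omega>. \<Sum>t\<in>T. c t * x t \<omega>))"

definition procH :: "'a measure \<Rightarrow> (real \<Rightarrow> 'a \<Rightarrow> real) set" where
  "procH M = {x. gaussian_process M x
     \<and> (\<forall>t\<in>{0..1}. (LINT \<omega>|M. x t \<omega>) = 0)
     \<and> (\<exists>Ct :: real \<Rightarrow> real. continuous_on UNIV Ct \<and>
          (\<forall>s\<in>{0..1}. \<forall>t\<in>{0..1}. covar M (x s) (x t) = Ct (s - t)))
     \<and> (AE \<omega> in M. x 0 \<omega> = x 1 \<omega>)}"

definition H_inner ::
    "'a measure \<Rightarrow> (real \<Rightarrow> 'a \<Rightarrow> real) \<Rightarrow> (real \<Rightarrow> 'a \<Rightarrow> real) \<Rightarrow> real" where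
  "H_inner M x y = (LINT t:{0..1}|lborel. (LINT \<omega>|M. x t \<omega> * y t \<omega>))"

definition H_norm :: "'a measure \<Rightarrow> (real \<Rightarrow> 'a \<Rightarrow> real) \<Rightarrow> real" where
  "H_norm M x = sqrt (H_inner M x x)"

definition ell2 :: "(nat \<Rightarrow> real) set" where
  "ell2 = {a. summable (\<lambda>n. (a n)\<^sup>2)}"

definition ell2_norm :: "(nat \<Rightarrow> real) \<Rightarrow> real" where
  "ell2_norm a = sqrt (\<Sum>n. (a n)\<^sup>2)"

definition gaussian_couple ::
    "'a measure \<Rightarrow> (nat \<Rightarrow> 'a \<Rightarrow> real) \<Rightarrow> (nat \<Rightarrow> 'a \<Rightarrow> real) \<Rightarrow> bool" where
  "gaussian_couple M Y Y' \<longleftrightarrow>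
     (\<forall>n. distributed M lborel (Y n) std_normal_density) \<and>
     (\<forall>n. distributed M lborel (Y' n) std_normal_density) \<and>
     prob_space.indep_vars M (\<lambda>_. borel) Y UNIV \<and>
     prob_space.indep_vars M (\<lambda>_. borel) Y' UNIV \<and>
     prob_space.indep_var M
       (PiM UNIV (\<lambda>_. borel)) (\<lambda>\<omega> n. Y n \<omega>)
       (PiM UNIV (\<lambda>_. borel)) (\<lambda>\<omega> n. Y' n \<omega>)"

definition ms_unif_limit ::
    "'a measure \<Rightarrow> (nat \<Rightarrow> real \<Rightarrow> 'a \<Rightarrow> real) \<Rightarrow> (real \<Rightarrow> 'a \<Rightarrow> real) \<Rightarrow> bool" where
  "ms_unif_limit M S x \<longleftrightarrow>
     (\<forall>n. \<forall>t\<in>{0..1}. square_integrable M (S n t)) \<and>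
     (\<forall>t\<in>{0..1}. square_integrable M (x t)) \<and>
     uniform_limit {0..1} (\<lambda>n t. LINT \<omega>|M. (S n t \<omega> - x t \<omega>)\<^sup>2) (\<lambda>_. 0) sequentially"

definition trig_partial ::
    "(nat \<Rightarrow> 'a \<Rightarrow> real) \<Rightarrow> (nat \<Rightarrow> 'a \<Rightarrow> real) \<Rightarrow> (nat \<Rightarrow> real) \<Rightarrow> nat \<Rightarrow> real \<Rightarrow> 'a \<Rightarrow> real" where
  "trig_partial Y Y' a n t \<omega> =
     a 0 * Y' 0 \<omega> + sqrt 2 * (\<Sum>k=1..n. a k *
       (Y k \<omega> * sin (2 * real k * pi * t) + Y' k \<omega> * cos (2 * real k * pi * t)))"

text \<open>The series determines each \<open>x t\<close> only up to a null set, so ``\<open>x\<close> is given by the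
  series'' is a relation between \<open>a\<close> and \<open>x\<close>.\<close>

definition trig_series ::
    "'a measure \<Rightarrow> (nat \<Rightarrow> 'a \<Rightarrow> real) \<Rightarrow> (nat \<Rightarrow> 'a \<Rightarrow> real) \<Rightarrow> (nat \<Rightarrow> real) \<Rightarrow>
     (real \<Rightarrow> 'a \<Rightarrow> real) \<Rightarrow> bool" where
  "trig_series M Y Y' a x \<longleftrightarrow> ms_unif_limit M (trig_partial Y Y' a) x"

definition procHZ ::
    "'a measure \<Rightarrow> (nat \<Rightarrow> 'a \<Rightarrow> real) \<Rightarrow> (nat \<Rightarrow> 'a \<Rightarrow> real) \<Rightarrow> (real \<Rightarrow> 'a \<Rightarrow> real) set" where
  "procHZ M Y Y' = {x \<in> procH M. \<exists>a\<in>ell2. trig_series M Y Y' a x}"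

text \<open>Equality of processes: \<open>x t = y t\<close> almost surely, for each \<open>t\<close>. The elements of the
  space of processes are the classes of this relation.\<close>

definition proc_eq ::
    "'a measure \<Rightarrow> (real \<Rightarrow> 'a \<Rightarrow> real) set \<Rightarrow>
     ((real \<Rightarrow> 'a \<Rightarrow> real) \<times> (real \<Rightarrow> 'a \<Rightarrow> real)) set" where
  "proc_eq M A = {(x, y). x \<in> A \<and> y \<in> A \<and> (\<forall>t\<in>{0..1}. AE \<omega> in M. x t \<omega> = y t \<omega>)}"

text \<open>Because of the factor 2 in the norm formula, the coefficient sequence itself does not
  preserve norms; the isometry sends the process with coefficients \<open>a\<close> to this sequence.\<close>

definition iso_coeffs :: "(nat \<Rightarrow> real) \<Rightarrow> nat \<Rightarrow> real" where
  "iso_coeffs a n = (if n = 0 then a 0 else sqrt 2 * a n)"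

text \<open>A surjective linear isometry from \<open>A\<close> modulo equality of processes onto \<open>ell2\<close>.\<close>

definition is_isometry ::
    "'a measure \<Rightarrow> (real \<Rightarrow> 'a \<Rightarrow> real) set \<Rightarrow>
     ((real \<Rightarrow> 'a \<Rightarrow> real) set \<Rightarrow> nat \<Rightarrow> real) \<Rightarrow> bool" where
  "is_isometry M A \<Phi> \<longleftrightarrow>
     equiv A (proc_eq M A) \<and>
     bij_betw \<Phi> (A // proc_eq M A) ell2 \<and>
     (\<forall>x\<in>A. \<forall>y\<in>A. \<forall>c d.
        (\<lambda>t \<omega>. c * x t \<omega> + d * y t \<omega>) \<in> A \<and>
        \<Phi> (proc_eq M A `` {\<lambda>t \<omega>. c * x t \<omega> + d * y t \<omega>}) =
          (\<lambda>n. c * \<Phi> (proc_eq M A `` {x}) n + d * \<Phi> (proc_eq M A `` {y}) n)) \<and>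
     (\<forall>x\<in>A. \<forall>y\<in>A.
        H_norm M (\<lambda>t \<omega>. x t \<omega> - y t \<omega>) =
          ell2_norm (\<lambda>n. \<Phi> (proc_eq M A `` {x}) n - \<Phi> (proc_eq M A `` {y}) n))"

end

theory Submission
  imports Defs
begin

text \<open>
  The variables \<open>Y k\<close>, \<open>Y' k\<close> form an orthonormal system in the space of square integrable
  random variables. Hence, at each time \<open>t\<close>, the squared distance between two partial sums of the
  series is a block of \<open>\<Sum> a\<^sub>k\<^sup>2 (2 sin\<^sup>2 + 2 cos\<^sup>2)\<close>; since \<open>sin\<^sup>2 + cos\<^sup>2 = 1\<close>, it is
  bounded by twice a block of \<open>\<Sum> a\<^sub>k\<^sup>2\<close>, whatever \<open>t\<close> is. Completeness therefore gives a mean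
  square limit, uniform in \<open>t\<close> (\<open>trig_series_exists\<close>, \<open>ms_complete\<close>).

  Covariances pass to mean square limits (\<open>ms_limit_inner\<close>), and the addition theorem for the
  cosine turns the covariance of \<open>x\<^sub>s\<close> and \<open>x\<^sub>t\<close> into
  \<open>a\<^sub>0\<^sup>2 + 2 \<Sum> a\<^sub>k\<^sup>2 cos (2 \<pi> k (s - t))\<close> (\<open>trig_series_covariance\<close>). This is a continuous
  function of \<open>s - t\<close>, so the process is stationary, and for \<open>s = t\<close> it is the constant
  \<open>a\<^sub>0\<^sup>2 + 2 \<Sum> a\<^sub>k\<^sup>2\<close>, whose integral over the unit interval is the squared norm.

  The limit is Gaussian because characteristic functions pass to mean square limits, and the
  one of a centred Gaussian variable is determined by its second moment, which passes to the
  limit too (\<open>ms_limit_gaussian\<close>); a vanishing limit of the second moments is where constant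
  variables come in.

  For the isometry, \<open>E (x\<^sub>0 Y'\<^sub>n)\<close> equals \<open>a\<^sub>0\<close> for \<open>n = 0\<close> and \<open>\<surd>2 a\<^sub>n\<close> otherwise, because
  every sine vanishes at time \<open>0\<close> (\<open>trig_series_coeffs\<close>). So the rescaled coefficients are
  determined by the process, depend only on its class, and the map is linear; the norm formula
  makes it isometric, uniqueness of limits injective, and existence of the series surjective
  (\<open>is_isometry_coeff_map\<close>).
\<close>

section \<open>Square integrable functions\<close>

lemma square_integrable_mult:
  assumes "square_integrable M X" "square_integrable M Y"
  shows "integrable M (\<lambda>\<omega>. X \<omega> * Y \<omega>)"
proof (rule Bochner_Integration.integrable_bound)
  show "integrable M (\<lambda>\<omega>. (X \<omega>)\<^sup>2 + (Y \<omega>)\<^sup>2)"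
    using assms by (auto simp: square_integrable_def)
  show "(\<lambda>\<omega>. X \<omega> * Y \<omega>) \<in> borel_measurable M"
    using assms by (auto simp: square_integrable_def)
  have "\<bar>x * y\<bar> \<le> x\<^sup>2 + y\<^sup>2" for x y :: real
  proof -
    have "2 * \<bar>x * y\<bar> \<le> x\<^sup>2 + y\<^sup>2"
      using sum_squares_bound[of "\<bar>x\<bar>" "\<bar>y\<bar>"] by (simp add: abs_mult mult.assoc)
    then show ?thesis
      using abs_ge_zero[of "x * y"] by linarith
  qed
  then show "AE \<omega> in M. norm (X \<omega> * Y \<omega>) \<le> norm ((X \<omega>)\<^sup>2 + (Y \<omega>)\<^sup>2)"
    by (auto intro: order_trans[OF _ abs_ge_self])
qed

lemma square_integrable_lincomb:
  assumes "square_integrable M X" "square_integrable M Y"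
  shows "square_integrable M (\<lambda>\<omega>. c * X \<omega> + d * Y \<omega>)"
proof -
  have "integrable M (\<lambda>\<omega>. c\<^sup>2 * (X \<omega>)\<^sup>2 + d\<^sup>2 * (Y \<omega>)\<^sup>2 + (2 * c * d) * (X \<omega> * Y \<omega>))"
    using assms square_integrable_mult[OF assms] by (auto simp: square_integrable_def)
  also have "(\<lambda>\<omega>. c\<^sup>2 * (X \<omega>)\<^sup>2 + d\<^sup>2 * (Y \<omega>)\<^sup>2 + (2 * c * d) * (X \<omega> * Y \<omega>))
      = (\<lambda>\<omega>. (c * X \<omega> + d * Y \<omega>)\<^sup>2)"
    by (simp add: fun_eq_iff power2_eq_square algebra_simps)
  finally show ?thesis
    using assms by (auto simp: square_integrable_def)
qed

lemma square_integrable_diff: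
  assumes "square_integrable M X" "square_integrable M Y"
  shows "square_integrable M (\<lambda>\<omega>. X \<omega> - Y \<omega>)"
  using square_integrable_lincomb[OF assms, of 1 "-1"] by simp

lemma square_integrable_zero: "square_integrable M (\<lambda>_. 0)"
  by (simp add: square_integrable_def)

lemma square_integrable_sum:
  assumes "\<And>i. i \<in> I \<Longrightarrow> square_integrable M (X i)"
  shows "square_integrable M (\<lambda>\<omega>. \<Sum>i\<in>I. c i * X i \<omega>)"
  using assms
proof (induction I rule: infinite_finite_induct)
  case (insert i I)
  then show ?case
    using square_integrable_lincomb[of M "X i" "\<lambda>\<omega>. \<Sum>i\<in>I. c i * X i \<omega>" "c i" 1] by auto
qed (auto simp: square_integrable_zero)

text \<open>The discriminant argument: the quadratic polynomial \<open>s \<mapsto> \<integral> (X + s Y)\<^sup>2\<close> is nonnegative.\<close>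

lemma cauchy_schwarz_integral:
  assumes X: "square_integrable M X" and Y: "square_integrable M Y"
  shows "\<bar>LINT \<omega>|M. X \<omega> * Y \<omega>\<bar> \<le> sqrt (LINT \<omega>|M. (X \<omega>)\<^sup>2) * sqrt (LINT \<omega>|M. (Y \<omega>)\<^sup>2)"
proof -
  define A B C where "A = (LINT \<omega>|M. (X \<omega>)\<^sup>2)" "B = (LINT \<omega>|M. X \<omega> * Y \<omega>)" "C = (LINT \<omega>|M. (Y \<omega>)\<^sup>2)"
  note ABC = this
  have int: "integrable M (\<lambda>\<omega>. (X \<omega>)\<^sup>2)" "integrable M (\<lambda>\<omega>. (Y \<omega>)\<^sup>2)" "integrable M (\<lambda>\<omega>. X \<omega> * Y \<omega>)"
    using assms square_integrable_mult[OF assms] by (auto simp: square_integrable_def)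
  have quad: "0 \<le> A + 2 * s * B + s\<^sup>2 * C" for s
  proof -
    have "0 \<le> (LINT \<omega>|M. (X \<omega> + s * Y \<omega>)\<^sup>2)"
      by simp
    also have "(\<lambda>\<omega>. (X \<omega> + s * Y \<omega>)\<^sup>2) = (\<lambda>\<omega>. (X \<omega>)\<^sup>2 + (2 * s) * (X \<omega> * Y \<omega>) + s\<^sup>2 * (Y \<omega>)\<^sup>2)"
      by (simp add: fun_eq_iff power2_eq_square algebra_simps)
    also have "(LINT \<omega>|M. (X \<omega>)\<^sup>2 + (2 * s) * (X \<omega> * Y \<omega>) + s\<^sup>2 * (Y \<omega>)\<^sup>2) = A + 2 * s * B + s\<^sup>2 * C"
      using int by (simp add: ABC)
    finally show ?thesis .
  qed
  have "B\<^sup>2 \<le> A * C"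
  proof (cases "C = 0")
    case True
    have "B = 0"
    proof (rule ccontr)
      assume "B \<noteq> 0"
      \<comment> \<open>This \<open>s\<close> makes the now affine expression equal to \<open>-1\<close>.\<close>
      then show False
        using quad[of "- (A + 1) / (2 * B)"] True by (simp add: field_simps)
    qed
    then show ?thesis
      using True by simp
  next
    case False
    then have "C > 0"
      by (simp add: ABC less_le)
    \<comment> \<open>The minimum of the quadratic polynomial is at \<open>- B / C\<close>.\<close>
    then show ?thesis
      using quad[of "- B / C"] by (simp add: field_simps power2_eq_square)
  qed
  then have "\<bar>B\<bar> \<le> sqrt (A * C)"
    using real_le_rsqrt by fastforce
  then show ?thesis
    by (simp add: ABC real_sqrt_mult)
qed

section \<open>Convergence in mean square\<close>

definition ms_limit :: "'a measure \<Rightarrow> (nat \<Rightarrow> 'a \<Rightarrow> real) \<Rightarrow> ('a \<Rightarrow> real) \<Rightarrow> bool" where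
  "ms_limit M X x \<longleftrightarrow> (\<forall>n. square_integrable M (X n)) \<and> square_integrable M x \<and>
     (\<lambda>n. LINT \<omega>|M. (X n \<omega> - x \<omega>)\<^sup>2) \<longlonglongrightarrow> 0"

lemma ms_limit_const: "square_integrable M x \<Longrightarrow> ms_limit M (\<lambda>_. x) x"
  by (simp add: ms_limit_def)

text \<open>From \<open>(u + v)\<^sup>2 \<le> 2 u\<^sup>2 + 2 v\<^sup>2\<close>. The explicit bound gives linearity of mean square limits
  both at a fixed time and uniformly in time.\<close>

lemma ms_dist_lincomb_le:
  assumes "square_integrable M X" "square_integrable M x" "square_integrable M Y" "square_integrable M y"
  shows "(LINT \<omega>|M. ((c * X \<omega> + d * Y \<omega>) - (c * x \<omega> + d * y \<omega>))\<^sup>2)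
    \<le> 2 * c\<^sup>2 * (LINT \<omega>|M. (X \<omega> - x \<omega>)\<^sup>2) + 2 * d\<^sup>2 * (LINT \<omega>|M. (Y \<omega> - y \<omega>)\<^sup>2)"
proof -
  have int: "integrable M (\<lambda>\<omega>. (X \<omega> - x \<omega>)\<^sup>2)" "integrable M (\<lambda>\<omega>. (Y \<omega> - y \<omega>)\<^sup>2)"
    using square_integrable_diff[OF assms(1,2)] square_integrable_diff[OF assms(3,4)]
    by (auto simp: square_integrable_def)
  have "(LINT \<omega>|M. ((c * X \<omega> + d * Y \<omega>) - (c * x \<omega> + d * y \<omega>))\<^sup>2)
    \<le> (LINT \<omega>|M. 2 * c\<^sup>2 * (X \<omega> - x \<omega>)\<^sup>2 + 2 * d\<^sup>2 * (Y \<omega> - y \<omega>)\<^sup>2)"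
  proof (rule integral_mono)
    show "integrable M (\<lambda>\<omega>. ((c * X \<omega> + d * Y \<omega>) - (c * x \<omega> + d * y \<omega>))\<^sup>2)"
      using square_integrable_diff[OF square_integrable_lincomb[OF assms(1,3)] square_integrable_lincomb[OF assms(2,4)]]
      by (auto simp: square_integrable_def)
    show "((c * X \<omega> + d * Y \<omega>) - (c * x \<omega> + d * y \<omega>))\<^sup>2
        \<le> 2 * c\<^sup>2 * (X \<omega> - x \<omega>)\<^sup>2 + 2 * d\<^sup>2 * (Y \<omega> - y \<omega>)\<^sup>2" for \<omega>
      using sum_squares_bound[of "c * (X \<omega> - x \<omega>)" "d * (Y \<omega> - y \<omega>)"]
      by (simp add: power2_eq_square algebra_simps)
  qed (use int in auto)
  also have "\<dots> = 2 * c\<^sup>2 * (LINT \<omega>|M. (X \<omega> - x \<omega>)\<^sup>2) + 2 * d\<^sup>2 * (LINT \<omega>|M. (Y \<omega> - y \<omega>)\<^sup>2)"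
    using int by simp
  finally show ?thesis .
qed

lemma ms_limit_lincomb:
  assumes "ms_limit M X x" "ms_limit M Y y"
  shows "ms_limit M (\<lambda>n \<omega>. c * X n \<omega> + d * Y n \<omega>) (\<lambda>\<omega>. c * x \<omega> + d * y \<omega>)"
  unfolding ms_limit_def
proof (intro conjI allI)
  show "(\<lambda>n. LINT \<omega>|M. ((c * X n \<omega> + d * Y n \<omega>) - (c * x \<omega> + d * y \<omega>))\<^sup>2) \<longlonglongrightarrow> 0"
  proof (rule tendsto_sandwich[where f = "\<lambda>_. 0"])
    show "(\<lambda>n. 2 * c\<^sup>2 * (LINT \<omega>|M. (X n \<omega> - x \<omega>)\<^sup>2) + 2 * d\<^sup>2 * (LINT \<omega>|M. (Y n \<omega> - y \<omega>)\<^sup>2)) \<longlonglongrightarrow> 0"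
      using assms by (auto simp: ms_limit_def intro!: tendsto_eq_intros)
    show "\<forall>\<^sub>F n in sequentially. (LINT \<omega>|M. ((c * X n \<omega> + d * Y n \<omega>) - (c * x \<omega> + d * y \<omega>))\<^sup>2)
       \<le> 2 * c\<^sup>2 * (LINT \<omega>|M. (X n \<omega> - x \<omega>)\<^sup>2) + 2 * d\<^sup>2 * (LINT \<omega>|M. (Y n \<omega> - y \<omega>)\<^sup>2)"
      by (intro always_eventually allI ms_dist_lincomb_le) (use assms in \<open>auto simp: ms_limit_def\<close>)
  qed auto
qed (use assms in \<open>auto simp: ms_limit_def intro: square_integrable_lincomb\<close>)

lemma ms_limit_sum:
  assumes "\<And>i. i \<in> I \<Longrightarrow> ms_limit M (\<lambda>n. X n i) (x i)"
  shows "ms_limit M (\<lambda>n \<omega>. \<Sum>i\<in>I. c i * X n i \<omega>) (\<lambda>\<omega>. \<Sum>i\<in>I. c i * x i \<omega>)"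
  using assms
proof (induction I rule: infinite_finite_induct)
  case (insert i I)
  then show ?case
    using ms_limit_lincomb[of M "\<lambda>n. X n i" "x i" "\<lambda>n \<omega>. \<Sum>i\<in>I. c i * X n i \<omega>"
        "\<lambda>\<omega>. \<Sum>i\<in>I. c i * x i \<omega>" "c i" 1] by auto
qed (auto intro: ms_limit_const square_integrable_zero)

text \<open>Joint continuity of the inner product. All moments of a limit process are computed from the
  partial sums through this lemma.\<close>

lemma ms_limit_inner:
  assumes "ms_limit M X x" "ms_limit M Y y"
  shows "(\<lambda>n. LINT \<omega>|M. X n \<omega> * Y n \<omega>) \<longlonglongrightarrow> (LINT \<omega>|M. x \<omega> * y \<omega>)"
proof -
  have sq: "square_integrable M (X n)" "square_integrable M x" "square_integrable M (Y n)" "square_integrable M y" for n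
    using assms by (auto simp: ms_limit_def)
  define D E where "D n = sqrt (LINT \<omega>|M. (X n \<omega> - x \<omega>)\<^sup>2)" "E n = sqrt (LINT \<omega>|M. (Y n \<omega> - y \<omega>)\<^sup>2)" for n
  have D: "D \<longlonglongrightarrow> 0" and E: "E \<longlonglongrightarrow> 0"
    using assms unfolding ms_limit_def D_E_def by (auto intro!: tendsto_eq_intros)
  define a b where "a = sqrt (LINT \<omega>|M. (x \<omega>)\<^sup>2)" "b = sqrt (LINT \<omega>|M. (y \<omega>)\<^sup>2)"
  have "(\<lambda>n. (LINT \<omega>|M. X n \<omega> * Y n \<omega>) - (LINT \<omega>|M. x \<omega> * y \<omega>)) \<longlonglongrightarrow> 0"
  proof (rule Lim_null_comparison)
    show "(\<lambda>n. D n * E n + D n * b + a * E n) \<longlonglongrightarrow> 0"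
      using D E by (auto intro!: tendsto_eq_intros)
    have "\<bar>(LINT \<omega>|M. X n \<omega> * Y n \<omega>) - (LINT \<omega>|M. x \<omega> * y \<omega>)\<bar> \<le> D n * E n + D n * b + a * E n" for n
    proof -
      have dX: "square_integrable M (\<lambda>\<omega>. X n \<omega> - x \<omega>)" and dY: "square_integrable M (\<lambda>\<omega>. Y n \<omega> - y \<omega>)"
        by (auto intro!: square_integrable_diff sq)
      have "(LINT \<omega>|M. X n \<omega> * Y n \<omega>) - (LINT \<omega>|M. x \<omega> * y \<omega>)
          = (LINT \<omega>|M. X n \<omega> * Y n \<omega> - x \<omega> * y \<omega>)"
        by (intro Bochner_Integration.integral_diff[symmetric] square_integrable_mult sq)
      also have "(\<lambda>\<omega>. X n \<omega> * Y n \<omega> - x \<omega> * y \<omega>) =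
          (\<lambda>\<omega>. ((X n \<omega> - x \<omega>) * (Y n \<omega> - y \<omega>) + (X n \<omega> - x \<omega>) * y \<omega>) + x \<omega> * (Y n \<omega> - y \<omega>))"
        by (simp add: fun_eq_iff algebra_simps)
      also have "(LINT \<omega>|M. ((X n \<omega> - x \<omega>) * (Y n \<omega> - y \<omega>) + (X n \<omega> - x \<omega>) * y \<omega>) + x \<omega> * (Y n \<omega> - y \<omega>))
         = (LINT \<omega>|M. (X n \<omega> - x \<omega>) * (Y n \<omega> - y \<omega>)) + (LINT \<omega>|M. (X n \<omega> - x \<omega>) * y \<omega>)
           + (LINT \<omega>|M. x \<omega> * (Y n \<omega> - y \<omega>))"
        by (subst Bochner_Integration.integral_add | intro Bochner_Integration.integrable_add square_integrable_mult sq dX dY refl)+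
      finally show ?thesis
        using cauchy_schwarz_integral[OF dX dY] cauchy_schwarz_integral[OF dX sq(4)]
          cauchy_schwarz_integral[OF sq(2) dY] unfolding D_E_def a_b_def by linarith
    qed
    then show "\<forall>\<^sub>F n in sequentially. norm ((LINT \<omega>|M. X n \<omega> * Y n \<omega>) - (LINT \<omega>|M. x \<omega> * y \<omega>))
        \<le> D n * E n + D n * b + a * E n"
      by auto
  qed
  then show ?thesis
    by (simp add: LIM_zero_iff)
qed

lemma ms_limit_unique:
  assumes "ms_limit M X x" "ms_limit M X y"
  shows "AE \<omega> in M. x \<omega> = y \<omega>"
proof -
  have lim: "ms_limit M (\<lambda>n \<omega>. 0) (\<lambda>\<omega>. x \<omega> - y \<omega>)"
    using ms_limit_lincomb[OF assms, of 1 "-1"] by simp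
  have "(LINT \<omega>|M. (x \<omega> - y \<omega>)\<^sup>2) = 0"
    using ms_limit_inner[OF lim lim] LIMSEQ_unique[OF _ tendsto_const]
    by (force simp: power2_eq_square)
  moreover have "integrable M (\<lambda>\<omega>. (x \<omega> - y \<omega>)\<^sup>2)"
    using lim by (simp add: ms_limit_def square_integrable_def)
  ultimately have "AE \<omega> in M. (x \<omega> - y \<omega>)\<^sup>2 = 0"
    by (subst (asm) integral_nonneg_eq_0_iff_AE) auto
  then show ?thesis by simp
qed

context prob_space
begin

lemma square_integrable_const: "square_integrable M (\<lambda>_. c)"
  by (simp add: square_integrable_def)

lemma square_integrable_imp_int: "square_integrable M X \<Longrightarrow> integrable M X"
  by (auto simp: square_integrable_def intro: square_integrable_imp_integrable)

lemma expectation_abs_le: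
  assumes "square_integrable M X"
  shows "expectation (\<lambda>\<omega>. \<bar>X \<omega>\<bar>) \<le> sqrt (expectation (\<lambda>\<omega>. (X \<omega>)\<^sup>2))"
proof -
  have "square_integrable M (\<lambda>\<omega>. \<bar>X \<omega>\<bar>)"
    using assms by (auto simp: square_integrable_def)
  from cauchy_schwarz_integral[OF this square_integrable_const[of 1]]
  show ?thesis by (simp add: prob_space)
qed

text \<open>The Riesz--Fischer argument: on a probability space a Cauchy sequence in mean square is Cauchy
  in mean, so some subsequence converges almost surely, and Fatou's lemma applied to
  \<open>(X\<^sub>n - X\<^sub>r\<^sub>i)\<^sup>2\<close> bounds the mean square distance of \<open>X\<^sub>n\<close> to the pointwise limit.\<close>

lemma ms_complete:
  assumes sq: "\<And>n. square_integrable M (X n)"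
    and cauchy: "\<And>e. e > 0 \<Longrightarrow> \<exists>N. \<forall>m\<ge>N. \<forall>n\<ge>N. expectation (\<lambda>\<omega>. (X m \<omega> - X n \<omega>)\<^sup>2) < e"
  shows "\<exists>x. ms_limit M X x"
proof -
  have [measurable]: "X n \<in> borel_measurable M" for n
    using sq by (simp add: square_integrable_def)
  have sqd: "square_integrable M (\<lambda>\<omega>. X m \<omega> - X n \<omega>)" for m n
    by (intro square_integrable_diff sq)
  have cauchy1: "\<exists>N. \<forall>i\<ge>N. \<forall>j\<ge>N. expectation (\<lambda>\<omega>. norm (X i \<omega> - X j \<omega>)) < e" if "e > 0" for e
  proof -
    obtain N where N: "expectation (\<lambda>\<omega>. (X m \<omega> - X n \<omega>)\<^sup>2) < e\<^sup>2" if "m \<ge> N" "n \<ge> N" for m n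
      using cauchy[of "e\<^sup>2"] \<open>e > 0\<close> by auto
    have "expectation (\<lambda>\<omega>. norm (X i \<omega> - X j \<omega>)) < e" if "i \<ge> N" "j \<ge> N" for i j
      using expectation_abs_le[OF sqd, of i j] real_sqrt_less_mono[OF N[OF that]] \<open>e > 0\<close> by simp
    then show ?thesis by blast
  qed
  obtain r where r: "strict_mono r" "AE \<omega> in M. Cauchy (\<lambda>i. X (r i) \<omega>)"
    using cauchy_L1_AE_cauchy_subseq[OF square_integrable_imp_int[OF sq] cauchy1] by blast
  define x where "x \<omega> = lim (\<lambda>i. X (r i) \<omega>)" for \<omega>
  have [measurable]: "x \<in> borel_measurable M"
    unfolding x_def by measurable
  have conv: "AE \<omega> in M. (\<lambda>i. X (r i) \<omega>) \<longlonglongrightarrow> x \<omega>"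
    using r(2) by eventually_elim (simp add: x_def Cauchy_convergent_iff convergent_LIMSEQ_iff)
  have bound: "\<exists>N. \<forall>n\<ge>N. integrable M (\<lambda>\<omega>. (X n \<omega> - x \<omega>)\<^sup>2) \<and> expectation (\<lambda>\<omega>. (X n \<omega> - x \<omega>)\<^sup>2) \<le> e"
    if e: "e > 0" for e
  proof -
    obtain N where N: "expectation (\<lambda>\<omega>. (X m \<omega> - X n \<omega>)\<^sup>2) < e" if "m \<ge> N" "n \<ge> N" for m n
      using cauchy[OF e] by auto
    have "integrable M (\<lambda>\<omega>. (X n \<omega> - x \<omega>)\<^sup>2) \<and> expectation (\<lambda>\<omega>. (X n \<omega> - x \<omega>)\<^sup>2) \<le> e" if n: "n \<ge> N" for n
    proof -
      have "(\<integral>\<^sup>+\<omega>. ennreal ((X n \<omega> - x \<omega>)\<^sup>2) \<partial>M)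
          = (\<integral>\<^sup>+\<omega>. liminf (\<lambda>i. ennreal ((X n \<omega> - X (r i) \<omega>)\<^sup>2)) \<partial>M)"
      proof (rule nn_integral_cong_AE)
        show "AE \<omega> in M. ennreal ((X n \<omega> - x \<omega>)\<^sup>2) = liminf (\<lambda>i. ennreal ((X n \<omega> - X (r i) \<omega>)\<^sup>2))"
          using conv
        proof eventually_elim
          case (elim \<omega>)
          have "(\<lambda>i. ennreal ((X n \<omega> - X (r i) \<omega>)\<^sup>2)) \<longlonglongrightarrow> ennreal ((X n \<omega> - x \<omega>)\<^sup>2)"
            by (intro tendsto_ennrealI tendsto_intros elim)
          then show ?case
            by (rule lim_imp_Liminf[OF sequentially_bot, symmetric])
        qed
      qed
      also have "\<dots> \<le> liminf (\<lambda>i. \<integral>\<^sup>+\<omega>. ennreal ((X n \<omega> - X (r i) \<omega>)\<^sup>2) \<partial>M)"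
        by (rule nn_integral_liminf) measurable
      also have "\<dots> \<le> liminf (\<lambda>i. ennreal e)"
      proof (rule Liminf_mono)
        show "\<forall>\<^sub>F i in sequentially. (\<integral>\<^sup>+\<omega>. ennreal ((X n \<omega> - X (r i) \<omega>)\<^sup>2) \<partial>M) \<le> ennreal e"
          using eventually_ge_at_top[of N]
        proof eventually_elim
          case (elim i)
          then have "r i \<ge> N"
            using seq_suble[OF r(1), of i] by linarith
          from N[OF n this] show ?case
            using sqd[of n "r i"]
            by (subst nn_integral_eq_integral) (auto simp: square_integrable_def intro: ennreal_leI)
        qed
      qed
      also have "\<dots> = ennreal e"
        by (simp add: Liminf_const)
      finally have le: "(\<integral>\<^sup>+\<omega>. ennreal ((X n \<omega> - x \<omega>)\<^sup>2) \<partial>M) \<le> ennreal e" .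
      then have int: "integrable M (\<lambda>\<omega>. (X n \<omega> - x \<omega>)\<^sup>2)"
        by (intro integrableI_nonneg) (auto simp: le_less_trans[OF le])
      then have "ennreal (expectation (\<lambda>\<omega>. (X n \<omega> - x \<omega>)\<^sup>2)) \<le> ennreal e"
        using le by (subst (asm) nn_integral_eq_integral) auto
      then show ?thesis
        using int e by simp
    qed
    then show ?thesis by blast
  qed
  obtain N where "integrable M (\<lambda>\<omega>. (X N \<omega> - x \<omega>)\<^sup>2)"
    using bound[of 1] by auto
  then have "square_integrable M (\<lambda>\<omega>. X N \<omega> - x \<omega>)"
    by (simp add: square_integrable_def)
  from square_integrable_diff[OF sq[of N] this] have sqx: "square_integrable M x"
    by simp
  have "(\<lambda>n. expectation (\<lambda>\<omega>. (X n \<omega> - x \<omega>)\<^sup>2)) \<longlonglongrightarrow> 0"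
  proof (rule LIMSEQ_I)
    fix e :: real assume "e > 0"
    then obtain N where "\<forall>n\<ge>N. expectation (\<lambda>\<omega>. (X n \<omega> - x \<omega>)\<^sup>2) \<le> e / 2"
      using bound[of "e / 2"] by auto
    then show "\<exists>N. \<forall>n\<ge>N. norm (expectation (\<lambda>\<omega>. (X n \<omega> - x \<omega>)\<^sup>2) - 0) < e"
      using \<open>e > 0\<close> by (intro exI[of _ N]) (auto intro: le_less_trans)
  qed
  with sq sqx show ?thesis
    by (auto simp: ms_limit_def)
qed

section \<open>Mean square limits of Gaussian variables\<close>

lemma char_distr_scale:
  assumes [measurable]: "X \<in> borel_measurable M"
  shows "char (distr M borel (\<lambda>\<omega>. c * X \<omega>)) t = char (distr M borel X) (c * t)"
  by (simp add: char_def integral_distr mult_ac)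

text \<open>The function \<open>u \<mapsto> exp (\<i> u)\<close> is 1-Lipschitz on the reals, so the characteristic functions at \<open>t\<close>
  differ by at most \<open>\<bar>t\<bar> E \<bar>X\<^sub>n - x\<bar>\<close>.\<close>

lemma ms_limit_char:
  assumes lim: "ms_limit M X x"
  shows "(\<lambda>n. char (distr M borel (X n)) t) \<longlonglongrightarrow> char (distr M borel x) t"
proof -
  have [measurable]: "X n \<in> borel_measurable M" "x \<in> borel_measurable M" for n
    using lim by (auto simp: ms_limit_def square_integrable_def)
  have lip: "cmod (iexp a - iexp b) \<le> \<bar>a - b\<bar>" for a b
  proof -
    have "iexp a - iexp b = iexp b * (iexp (a - b) - 1)"
      by (simp add: algebra_simps flip: exp_add)
    then show ?thesis
      using iexp_approx1[of "a - b" 0] by (simp add: norm_mult)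
  qed
  have "(\<lambda>n. char (distr M borel (X n)) t - char (distr M borel x) t) \<longlonglongrightarrow> 0"
  proof (rule Lim_null_comparison)
    show "(\<lambda>n. \<bar>t\<bar> * sqrt (expectation (\<lambda>\<omega>. (X n \<omega> - x \<omega>)\<^sup>2))) \<longlonglongrightarrow> 0"
      using lim by (auto simp: ms_limit_def intro!: tendsto_eq_intros)
    have "cmod (char (distr M borel (X n)) t - char (distr M borel x) t)
        \<le> \<bar>t\<bar> * sqrt (expectation (\<lambda>\<omega>. (X n \<omega> - x \<omega>)\<^sup>2))" for n
    proof -
      have sq: "square_integrable M (\<lambda>\<omega>. X n \<omega> - x \<omega>)"
        using lim by (auto simp: ms_limit_def intro: square_integrable_diff)
      have "char (distr M borel (X n)) t - char (distr M borel x) t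
          = (CLINT \<omega>|M. iexp (t * X n \<omega>) - iexp (t * x \<omega>))"
        unfolding char_def by (subst (1 2) integral_distr; simp?)
          (subst Bochner_Integration.integral_diff; auto intro!: integrable_iexp)
      also have "cmod \<dots> \<le> (LINT \<omega>|M. cmod (iexp (t * X n \<omega>) - iexp (t * x \<omega>)))"
        by (rule integral_norm_bound)
      also have "\<dots> \<le> (LINT \<omega>|M. \<bar>t\<bar> * \<bar>X n \<omega> - x \<omega>\<bar>)"
      proof (rule integral_mono)
        show "integrable M (\<lambda>\<omega>. cmod (iexp (t * X n \<omega>) - iexp (t * x \<omega>)))"
          by (intro integrable_norm Bochner_Integration.integrable_diff integrable_iexp) auto
        show "integrable M (\<lambda>\<omega>. \<bar>t\<bar> * \<bar>X n \<omega> - x \<omega>\<bar>)"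
          using square_integrable_imp_int[OF sq] by auto
        show "cmod (iexp (t * X n \<omega>) - iexp (t * x \<omega>)) \<le> \<bar>t\<bar> * \<bar>X n \<omega> - x \<omega>\<bar>" for \<omega>
          using lip[of "t * X n \<omega>" "t * x \<omega>"] by (simp add: abs_mult flip: right_diff_distrib)
      qed
      also have "\<dots> \<le> \<bar>t\<bar> * sqrt (expectation (\<lambda>\<omega>. (X n \<omega> - x \<omega>)\<^sup>2))"
        using expectation_abs_le[OF sq] by (simp add: mult_left_mono)
      finally show ?thesis .
    qed
    then show "\<forall>\<^sub>F n in sequentially. cmod (char (distr M borel (X n)) t - char (distr M borel x) t)
        \<le> \<bar>t\<bar> * sqrt (expectation (\<lambda>\<omega>. (X n \<omega> - x \<omega>)\<^sup>2))"
      by auto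
  qed
  then show ?thesis
    by (simp add: LIM_zero_iff)
qed

text \<open>The variance \<open>v\<close> may vanish, when the variable is almost surely \<open>0\<close> and has no density. Both
  cases are identified by the uniqueness theorem for characteristic functions.\<close>

lemma gaussian_rv_if_char:
  assumes [measurable]: "X \<in> borel_measurable M" and "v \<ge> 0"
    and ch: "\<And>t. char (distr M borel X) t = of_real (exp (- (v * t\<^sup>2) / 2))"
  shows "gaussian_rv M X"
proof (cases "v = 0")
  case True
  interpret R: prob_space "return borel (0::real)"
    by (rule prob_space_return) auto
  have "char (return borel 0) t = 1" for t
    by (simp add: char_def integral_return)
  then have D: "distr M borel X = return borel 0"
    by (intro Levy_uniqueness)
      (auto simp: fun_eq_iff ch True R.prob_space_axioms real_distribution_axioms_def intro!: real_distribution.intro prob_space_distr)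
  have "AE y in distr M borel X. y = 0"
    unfolding D by (subst AE_return) auto
  then have "AE \<omega> in M. X \<omega> = 0"
    by (subst (asm) AE_distr_iff) auto
  then show ?thesis
    by (auto simp: gaussian_rv_def)
next
  case False
  with \<open>v \<ge> 0\<close> have v: "v > 0" by simp
  have "distr M borel (\<lambda>\<omega>. (1 / sqrt v) * X \<omega>) = std_normal_distribution"
  proof (rule Levy_uniqueness)
    show "char (distr M borel (\<lambda>\<omega>. (1 / sqrt v) * X \<omega>)) = char std_normal_distribution"
      using v char_distr_scale[of X "1 / sqrt v"] by (simp add: fun_eq_iff ch char_std_normal_distribution power_divide power_mult_distrib)
  qed (auto intro: real_dist_normal_dist)
  then have "distributed M lborel (\<lambda>\<omega>. (X \<omega> - 0) / sqrt v) std_normal_density"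
    by (auto simp: distributed_def cong: distr_cong)
  then have "distributed M lborel X (normal_density 0 (sqrt v))"
    using v by (subst normal_standard_normal_convert) auto
  then show ?thesis
    unfolding gaussian_rv_def using v by (intro conjI disjI2 exI[of _ 0] exI[of _ "sqrt v"]) auto
qed

text \<open>The hypothesis is phrased with the second moments themselves, because their convergence comes
  for free from the mean square convergence.\<close>

lemma ms_limit_gaussian:
  assumes lim: "ms_limit M X x"
    and ch: "\<And>n t. char (distr M borel (X n)) t = of_real (exp (- (expectation (\<lambda>\<omega>. (X n \<omega>)\<^sup>2) * t\<^sup>2) / 2))"
  shows "gaussian_rv M x"
proof (rule gaussian_rv_if_char)
  show "x \<in> borel_measurable M"
    using lim by (simp add: ms_limit_def square_integrable_def)
  show "char (distr M borel x) t = of_real (exp (- (expectation (\<lambda>\<omega>. (x \<omega>)\<^sup>2) * t\<^sup>2) / 2))" for t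
  proof (rule LIMSEQ_unique[OF ms_limit_char[OF lim]])
    have "(\<lambda>n. expectation (\<lambda>\<omega>. (X n \<omega>)\<^sup>2)) \<longlonglongrightarrow> expectation (\<lambda>\<omega>. (x \<omega>)\<^sup>2)"
      using ms_limit_inner[OF lim lim] by (simp add: power2_eq_square)
    then show "(\<lambda>n. char (distr M borel (X n)) t) \<longlonglongrightarrow> of_real (exp (- (expectation (\<lambda>\<omega>. (x \<omega>)\<^sup>2) * t\<^sup>2) / 2))"
      unfolding ch by (intro tendsto_intros) simp_all
  qed
qed simp

section \<open>Independent standard Gaussian variables\<close>

lemma std_normal_square_integrable:
  assumes D: "distributed M lborel X std_normal_density"
  shows "square_integrable M X"
  unfolding square_integrable_def
proof
  show "random_variable borel X"
    using distributed_measurable[OF D] by simp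
  show "integrable M (\<lambda>\<omega>. (X \<omega>)\<^sup>2)"
    using integrable_std_normal_moment[of 2]
    by (subst distributed_integrable[OF D, symmetric]) auto
qed

lemma std_normal_second_moment:
  assumes D: "distributed M lborel X std_normal_density"
  shows "expectation (\<lambda>\<omega>. X \<omega> * X \<omega>) = 1"
  using standard_normal_distributed_variance[OF D] standard_normal_distributed_expectation[OF D]
  by (simp add: power2_eq_square)

lemma std_normal_char:
  assumes D: "distributed M lborel X std_normal_density"
  shows "char (distr M borel X) t = of_real (exp (- t\<^sup>2 / 2))"
proof -
  have "distr M borel X = std_normal_distribution"
    using distributed_distr_eq_density[OF D] by (simp cong: distr_cong)
  then show ?thesis
    by (simp add: char_std_normal_distribution)
qed

lemma indep_std_normal_orthonormal:
  assumes "indep_vars (\<lambda>_. borel) X UNIV" "\<And>n. distributed M lborel (X n) std_normal_density"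
  shows "expectation (\<lambda>\<omega>. X j \<omega> * X k \<omega>) = (if j = k then 1 else 0)"
proof (cases "j = k")
  case False
  have "expectation (\<lambda>\<omega>. \<Prod>i\<in>{j, k}. X i \<omega>) = (\<Prod>i\<in>{j, k}. expectation (X i))"
    by (intro indep_vars_lebesgue_integral indep_vars_subset[OF assms(1)]
        square_integrable_imp_int std_normal_square_integrable assms(2)) auto
  with False show ?thesis
    by (simp add: standard_normal_distributed_expectation[OF assms(2)])
qed (simp add: std_normal_second_moment assms(2))

text \<open>Working with characteristic functions instead of densities allows all weights to vanish.\<close>

lemma char_indep_std_normal_sum:
  assumes "indep_vars (\<lambda>_. borel) X UNIV" "\<And>n. distributed M lborel (X n) std_normal_density"
    and "finite I"
  shows "char (distr M borel (\<lambda>\<omega>. \<Sum>k\<in>I. p k * X k \<omega>)) t = of_real (exp (- ((\<Sum>k\<in>I. (p k)\<^sup>2) * t\<^sup>2) / 2))"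
proof -
  have [measurable]: "X k \<in> borel_measurable M" for k
    using std_normal_square_integrable[OF assms(2)] by (simp add: square_integrable_def)
  have "indep_vars (\<lambda>_. borel) (\<lambda>k \<omega>. p k * X k \<omega>) I"
    by (rule indep_vars_compose2[OF indep_vars_subset[OF assms(1)]]) auto
  then have "char (distr M borel (\<lambda>\<omega>. \<Sum>k\<in>I. p k * X k \<omega>)) t
      = (\<Prod>k\<in>I. char (distr M borel (\<lambda>\<omega>. p k * X k \<omega>)) t)"
    by (rule char_distr_sum)
  also have "\<dots> = (\<Prod>k\<in>I. of_real (exp (- (p k * t)\<^sup>2 / 2)))"
    by (intro prod.cong refl) (simp add: char_distr_scale std_normal_char[OF assms(2)])
  also have "\<dots> = of_real (exp (\<Sum>k\<in>I. - (p k * t)\<^sup>2 / 2))"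
    by (simp add: exp_sum \<open>finite I\<close>)
  also have "(\<Sum>k\<in>I. - (p k * t)\<^sup>2 / 2) = - ((\<Sum>k\<in>I. (p k)\<^sup>2) * t\<^sup>2) / 2"
    by (simp add: sum_negf sum_divide_distrib sum_distrib_right power_mult_distrib)
  finally show ?thesis .
qed

end

section \<open>Square summable sequences\<close>

lemma ell2_lincomb:
  assumes "a \<in> ell2" "b \<in> ell2"
  shows "(\<lambda>k. c * a k + d * b k) \<in> ell2"
proof -
  have s: "summable (\<lambda>k. 2 * c\<^sup>2 * (a k)\<^sup>2 + 2 * d\<^sup>2 * (b k)\<^sup>2)"
    using assms by (intro summable_add summable_mult) (auto simp: ell2_def)
  have "(c * a k + d * b k)\<^sup>2 \<le> 2 * c\<^sup>2 * (a k)\<^sup>2 + 2 * d\<^sup>2 * (b k)\<^sup>2" for k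
    using sum_squares_bound[of "c * a k" "d * b k"]
    by (simp add: power2_eq_square algebra_simps)
  then have "norm ((c * a k + d * b k)\<^sup>2) \<le> 2 * c\<^sup>2 * (a k)\<^sup>2 + 2 * d\<^sup>2 * (b k)\<^sup>2" for k
    by simp
  then have "summable (\<lambda>k. (c * a k + d * b k)\<^sup>2)"
    by (rule summable_comparison_test'[OF s])
  then show ?thesis
    by (simp add: ell2_def)
qed

text \<open>The factor \<open>\<surd>2\<close> in \<open>iso_coeffs\<close> is what turns the \<open>\<ell>\<^sup>2\<close> norm into the norm of the process.\<close>

lemma iso_coeffs_square_sums:
  assumes "a \<in> ell2"
  shows "(\<lambda>n. (iso_coeffs a n)\<^sup>2) sums ((a 0)\<^sup>2 + 2 * (\<Sum>n. (a (Suc n))\<^sup>2))"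
proof -
  have "(\<lambda>n. (a (Suc n))\<^sup>2) sums (\<Sum>n. (a (Suc n))\<^sup>2)"
    using assms by (auto simp: ell2_def summable_Suc_iff[of "\<lambda>n. (a n)\<^sup>2"])
  from sums_mult[OF this, of 2]
  have "(\<lambda>n. (iso_coeffs a (Suc n))\<^sup>2) sums (2 * (\<Sum>n. (a (Suc n))\<^sup>2))"
    by (simp add: iso_coeffs_def power_mult_distrib)
  from sums_Suc[OF this] show ?thesis
    by (simp add: iso_coeffs_def add.commute)
qed

lemma iso_coeffs_inject: "iso_coeffs a = iso_coeffs b \<longleftrightarrow> a = b"
  by (auto simp: fun_eq_iff iso_coeffs_def split: if_splits)

lemma iso_coeffs_surj:
  assumes "b \<in> ell2"
  obtains a where "a \<in> ell2" "iso_coeffs a = b"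
proof
  let ?a = "\<lambda>n. if n = 0 then b 0 else b n / sqrt 2"
  have s: "summable (\<lambda>n. (b n)\<^sup>2)"
    using assms by (simp add: ell2_def)
  have "norm ((?a n)\<^sup>2) \<le> (b n)\<^sup>2" for n
    by (simp add: power_divide)
  then have "summable (\<lambda>n. (?a n)\<^sup>2)"
    by (rule summable_comparison_test'[OF s])
  then show "?a \<in> ell2"
    by (simp add: ell2_def)
  show "iso_coeffs ?a = b"
    by (auto simp: iso_coeffs_def)
qed

section \<open>Equality of processes\<close>

lemma equiv_proc_eq: "equiv A (proc_eq M A)"
proof (rule equivI)
  show "trans (proc_eq M A)"
    unfolding proc_eq_def
  proof (rule transI, clarsimp)
    fix x y z :: "real \<Rightarrow> 'a \<Rightarrow> real" and t :: real
    assume "\<forall>t\<in>{0..1}. AE \<omega> in M. x t \<omega> = y t \<omega>" "\<forall>t\<in>{0..1}. AE \<omega> in M. y t \<omega> = z t \<omega>"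
      and "0 \<le> t" "t \<le> 1"
    then have "AE \<omega> in M. x t \<omega> = y t \<omega>" "AE \<omega> in M. y t \<omega> = z t \<omega>"
      by auto
    then show "AE \<omega> in M. x t \<omega> = z t \<omega>"
      by eventually_elim simp
  qed
qed (auto simp: proc_eq_def refl_on_def sym_def eq_commute)

section \<open>The trigonometric basis\<close>

definition sin_basis :: "nat \<Rightarrow> real \<Rightarrow> real" where
  "sin_basis k t = sqrt 2 * sin (2 * real k * pi * t)"

definition cos_basis :: "nat \<Rightarrow> real \<Rightarrow> real" where
  "cos_basis k t = (if k = 0 then 1 else sqrt 2 * cos (2 * real k * pi * t))"

text \<open>The contribution of frequency \<open>k\<close> to the covariance at time lag \<open>u\<close>, for \<open>a\<^sub>k = 1\<close>.\<close>

definition cov_kernel :: "nat \<Rightarrow> real \<Rightarrow> real" where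
  "cov_kernel k u = (if k = 0 then 1 else 2 * cos (2 * real k * pi * u))"

text \<open>The addition theorem for the cosine: the sine and cosine parts share the coefficient \<open>a\<^sub>k\<close>, and
  this is why the resulting process is stationary.\<close>

lemma basis_cov_kernel: "sin_basis k s * sin_basis k t + cos_basis k s * cos_basis k t = cov_kernel k (s - t)"
proof -
  have two: "sqrt 2 * x * (sqrt 2 * y) = 2 * (x * y)" for x y
    by simp
  show ?thesis
    by (simp add: sin_basis_def cos_basis_def cov_kernel_def right_diff_distrib cos_diff two)
qed

lemma cov_kernel_bound: "\<bar>cov_kernel k u\<bar> \<le> 2"
  by (simp add: cov_kernel_def abs_mult)

section \<open>Finite combinations of the Gaussian couple\<close>

locale gaussian_pair = prob_space +
  fixes Y Y' :: "nat \<Rightarrow> 'a \<Rightarrow> real"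
  assumes couple: "gaussian_couple M Y Y'"
begin

lemma std_normal_distributed:
  "distributed M lborel (Y n) std_normal_density" "distributed M lborel (Y' n) std_normal_density"
  using couple by (auto simp: gaussian_couple_def)

lemmas sq_Y = std_normal_square_integrable[OF std_normal_distributed(1)]
  and sq_Y' = std_normal_square_integrable[OF std_normal_distributed(2)]

lemma measurable_YY' [measurable]: "Y n \<in> borel_measurable M" "Y' n \<in> borel_measurable M"
  using sq_Y sq_Y' by (auto simp: square_integrable_def)

text \<open>Independence of the two whole sequences is inherited by measurable functionals of them; it is
  used for single coordinates and for finite linear combinations.\<close>

lemma indep_functionals:
  assumes "f \<in> borel_measurable (PiM UNIV (\<lambda>_::nat. borel))" "g \<in> borel_measurable (PiM UNIV (\<lambda>_::nat. borel))"
  shows "indep_var borel (\<lambda>\<omega>. f (\<lambda>n. Y n \<omega>)) borel (\<lambda>\<omega>. g (\<lambda>n. Y' n \<omega>))"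
proof -
  have "indep_var (PiM UNIV (\<lambda>_. borel)) (\<lambda>\<omega> n. Y n \<omega>) (PiM UNIV (\<lambda>_. borel)) (\<lambda>\<omega> n. Y' n \<omega>)"
    using couple by (simp add: gaussian_couple_def)
  from indep_var_compose[OF this assms] show ?thesis
    by (simp add: comp_def)
qed

lemma orthonormal:
  "expectation (\<lambda>\<omega>. Y j \<omega> * Y k \<omega>) = (if j = k then 1 else 0)"
  "expectation (\<lambda>\<omega>. Y' j \<omega> * Y' k \<omega>) = (if j = k then 1 else 0)"
  "expectation (\<lambda>\<omega>. Y j \<omega> * Y' k \<omega>) = 0"
  "expectation (\<lambda>\<omega>. Y' j \<omega> * Y k \<omega>) = 0"
proof -
  show "expectation (\<lambda>\<omega>. Y j \<omega> * Y k \<omega>) = (if j = k then 1 else 0)"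
    "expectation (\<lambda>\<omega>. Y' j \<omega> * Y' k \<omega>) = (if j = k then 1 else 0)"
    using couple by (auto intro!: indep_std_normal_orthonormal simp only: gaussian_couple_def)
  show cross: "expectation (\<lambda>\<omega>. Y j \<omega> * Y' k \<omega>) = 0" for j k
  proof -
    have "indep_var borel (\<lambda>\<omega>. Y j \<omega>) borel (\<lambda>\<omega>. Y' k \<omega>)"
      by (rule indep_functionals[of "\<lambda>y. y j" "\<lambda>y. y k"]) auto
    from indep_var_lebesgue_integral[OF this] show ?thesis
      by (simp add: square_integrable_imp_int[OF sq_Y] square_integrable_imp_int[OF sq_Y']
          standard_normal_distributed_expectation[OF std_normal_distributed(1)])
  qed
  show "expectation (\<lambda>\<omega>. Y' j \<omega> * Y k \<omega>) = 0"
    using cross[of k j] by (simp add: mult.commute)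
qed

text \<open>Allowing arbitrary weights makes this family closed under linear combinations, so that it contains
  the partial sums, their differences, and their linear combinations over several times.\<close>

definition gsum :: "nat set \<Rightarrow> (nat \<Rightarrow> real) \<Rightarrow> (nat \<Rightarrow> real) \<Rightarrow> 'a \<Rightarrow> real" where
  "gsum I p q \<omega> = (\<Sum>k\<in>I. p k * Y k \<omega> + q k * Y' k \<omega>)"

lemma square_integrable_gsum: "square_integrable M (gsum I p q)"
proof -
  have "square_integrable M (\<lambda>\<omega>. \<Sum>k\<in>I. 1 * (p k * Y k \<omega> + q k * Y' k \<omega>))"
    by (intro square_integrable_sum square_integrable_lincomb sq_Y sq_Y')
  then show ?thesis
    by (simp add: gsum_def[abs_def])
qed

lemma expectation_gsum: "expectation (gsum I p q) = 0"
proof -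
  have "expectation (gsum I p q) = (\<Sum>k\<in>I. p k * expectation (Y k) + q k * expectation (Y' k))"
    unfolding gsum_def[abs_def]
    by (subst Bochner_Integration.integral_sum)
      (auto simp: square_integrable_imp_int[OF sq_Y] square_integrable_imp_int[OF sq_Y'])
  then show ?thesis
    by (simp add: std_normal_distributed standard_normal_distributed_expectation)
qed

lemma inner_gsum:
  assumes "finite I"
  shows "expectation (\<lambda>\<omega>. gsum I p q \<omega> * gsum I p' q' \<omega>) = (\<Sum>k\<in>I. p k * p' k + q k * q' k)"
proof -
  have one: "expectation (\<lambda>\<omega>. (p j * Y j \<omega> + q j * Y' j \<omega>) * (p' k * Y k \<omega> + q' k * Y' k \<omega>))
      = (if j = k then p k * p' k + q k * q' k else 0)" for j k
  proof -
    have "expectation (\<lambda>\<omega>. (p j * Y j \<omega> + q j * Y' j \<omega>) * (p' k * Y k \<omega> + q' k * Y' k \<omega>))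
      = expectation (\<lambda>\<omega>. (p j * p' k) * (Y j \<omega> * Y k \<omega>) + (p j * q' k) * (Y j \<omega> * Y' k \<omega>)
         + (q j * p' k) * (Y' j \<omega> * Y k \<omega>) + (q j * q' k) * (Y' j \<omega> * Y' k \<omega>))"
      by (simp add: algebra_simps)
    also have "\<dots> = (p j * p' k) * expectation (\<lambda>\<omega>. Y j \<omega> * Y k \<omega>) + (p j * q' k) * expectation (\<lambda>\<omega>. Y j \<omega> * Y' k \<omega>)
         + (q j * p' k) * expectation (\<lambda>\<omega>. Y' j \<omega> * Y k \<omega>) + (q j * q' k) * expectation (\<lambda>\<omega>. Y' j \<omega> * Y' k \<omega>)"
      using square_integrable_mult[OF sq_Y sq_Y] square_integrable_mult[OF sq_Y sq_Y']
        square_integrable_mult[OF sq_Y' sq_Y] square_integrable_mult[OF sq_Y' sq_Y']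
      by simp
    finally show ?thesis
      by (simp add: orthonormal)
  qed
  have int: "integrable M (\<lambda>\<omega>. (p j * Y j \<omega> + q j * Y' j \<omega>) * (p' k * Y k \<omega> + q' k * Y' k \<omega>))" for j k
    by (intro square_integrable_mult square_integrable_lincomb sq_Y sq_Y')
  have "expectation (\<lambda>\<omega>. gsum I p q \<omega> * gsum I p' q' \<omega>)
      = (\<Sum>j\<in>I. \<Sum>k\<in>I. expectation (\<lambda>\<omega>. (p j * Y j \<omega> + q j * Y' j \<omega>) * (p' k * Y k \<omega> + q' k * Y' k \<omega>)))"
    unfolding gsum_def sum_product using int
    by (subst Bochner_Integration.integral_sum, simp, subst Bochner_Integration.integral_sum) auto
  also have "\<dots> = (\<Sum>k\<in>I. p k * p' k + q k * q' k)"
    using assms by (simp add: one)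
  finally show ?thesis .
qed

text \<open>The sums over \<open>Y\<close> and over \<open>Y'\<close> are independent of each other, so their characteristic functions
  multiply and the exponents add up.\<close>

lemma char_gsum:
  assumes "finite I"
  shows "char (distr M borel (gsum I p q)) t
    = of_real (exp (- (expectation (\<lambda>\<omega>. (gsum I p q \<omega>)\<^sup>2) * t\<^sup>2) / 2))"
proof -
  have "indep_var borel (\<lambda>\<omega>. \<Sum>k\<in>I. p k * Y k \<omega>) borel (\<lambda>\<omega>. \<Sum>k\<in>I. q k * Y' k \<omega>)"
    by (rule indep_functionals[of "\<lambda>y. \<Sum>k\<in>I. p k * y k" "\<lambda>y. \<Sum>k\<in>I. q k * y k"]) measurable
  from char_distr_add[OF this, of t]
  have "char (distr M borel (gsum I p q)) t = char (distr M borel (\<lambda>\<omega>. \<Sum>k\<in>I. p k * Y k \<omega>)) t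
      * char (distr M borel (\<lambda>\<omega>. \<Sum>k\<in>I. q k * Y' k \<omega>)) t"
    by (simp add: gsum_def[abs_def] sum.distrib)
  also have "\<dots> = of_real (exp (- ((\<Sum>k\<in>I. (p k)\<^sup>2) * t\<^sup>2) / 2)) * of_real (exp (- ((\<Sum>k\<in>I. (q k)\<^sup>2) * t\<^sup>2) / 2))"
    using couple assms by (simp add: char_indep_std_normal_sum gaussian_couple_def)
  also have "\<dots> = of_real (exp (- ((\<Sum>k\<in>I. p k * p k + q k * q k) * t\<^sup>2) / 2))"
    by (simp add: power2_eq_square sum.distrib ring_distribs diff_divide_distrib flip: of_real_mult exp_add)
  finally show ?thesis
    using inner_gsum[OF assms, of p q p q] by (simp add: power2_eq_square)
qed

lemma gsum_lincomb:
  "c * gsum I p q \<omega> + d * gsum I p' q' \<omega> = gsum I (\<lambda>k. c * p k + d * p' k) (\<lambda>k. c * q k + d * q' k) \<omega>"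
  by (simp add: gsum_def sum_distrib_left algebra_simps flip: sum.distrib)

lemma gsum_sum:
  "(\<Sum>t\<in>T. c t * gsum I (p t) (q t) \<omega>) = gsum I (\<lambda>k. \<Sum>t\<in>T. c t * p t k) (\<lambda>k. \<Sum>t\<in>T. c t * q t k) \<omega>"
proof -
  have "(\<Sum>t\<in>T. c t * gsum I (p t) (q t) \<omega>)
      = (\<Sum>k\<in>I. \<Sum>t\<in>T. c t * (p t k * Y k \<omega> + q t k * Y' k \<omega>))"
    unfolding gsum_def sum_distrib_left by (rule sum.swap)
  also have "\<dots> = gsum I (\<lambda>k. \<Sum>t\<in>T. c t * p t k) (\<lambda>k. \<Sum>t\<in>T. c t * q t k) \<omega>"
    by (simp add: gsum_def sum_distrib_right distrib_left mult.assoc sum.distrib)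
  finally show ?thesis .
qed

section \<open>Partial sums of the trigonometric series\<close>

text \<open>The summand for \<open>k = 0\<close> has a vanishing sine part, so the constant term needs no separate treatment.\<close>

lemma trig_partial_eq_gsum:
  "trig_partial Y Y' a n t = gsum {..n} (\<lambda>k. a k * sin_basis k t) (\<lambda>k. a k * cos_basis k t)"
proof
  fix \<omega>
  have "{..n} = insert 0 {1..n}"
    by auto
  moreover have "(\<Sum>k=1..n. a k * sin_basis k t * Y k \<omega> + a k * cos_basis k t * Y' k \<omega>)
      = sqrt 2 * (\<Sum>k=1..n. a k * (Y k \<omega> * sin (2 * real k * pi * t) + Y' k \<omega> * cos (2 * real k * pi * t)))"
    unfolding sum_distrib_left
    by (intro sum.cong refl) (simp add: sin_basis_def cos_basis_def algebra_simps)
  ultimately show "trig_partial Y Y' a n t \<omega> = gsum {..n} (\<lambda>k. a k * sin_basis k t) (\<lambda>k. a k * cos_basis k t) \<omega>"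
    by (simp add: trig_partial_def gsum_def) (simp add: sin_basis_def cos_basis_def)
qed

lemma square_integrable_trig_partial: "square_integrable M (trig_partial Y Y' a n t)"
  unfolding trig_partial_eq_gsum by (rule square_integrable_gsum)

lemma trig_partial_lincomb:
  "trig_partial Y Y' (\<lambda>k. c * a k + d * b k) n t \<omega>
    = c * trig_partial Y Y' a n t \<omega> + d * trig_partial Y Y' b n t \<omega>"
  unfolding trig_partial_eq_gsum gsum_lincomb by (simp add: algebra_simps)

lemma inner_trig_partial:
  "expectation (\<lambda>\<omega>. trig_partial Y Y' a n s \<omega> * trig_partial Y Y' a n t \<omega>)
    = (\<Sum>k\<le>n. (a k)\<^sup>2 * cov_kernel k (s - t))"
  unfolding trig_partial_eq_gsum
  by (subst inner_gsum) (simp_all add: basis_cov_kernel[symmetric] power2_eq_square algebra_simps)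

text \<open>The difference of two partial sums is a block of the series, and by orthonormality its second
  moment is at most \<open>2 \<Sum> a\<^sub>k\<^sup>2\<close> over the block. The bound does not depend on \<open>t\<close>: it gives
  existence of the limit and uniformity at once.\<close>

lemma trig_partial_dist_le:
  "expectation (\<lambda>\<omega>. (trig_partial Y Y' a m t \<omega> - trig_partial Y Y' a n t \<omega>)\<^sup>2)
    \<le> 2 * \<bar>(\<Sum>k\<le>m. (a k)\<^sup>2) - (\<Sum>k\<le>n. (a k)\<^sup>2)\<bar>"
proof (induction m n rule: linorder_wlog)
  case (sym m n)
  then show ?case
    by (simp add: power2_commute abs_minus_commute)
next
  case (le m n)
  have split: "{..n} = {..m} \<union> {m<..n}" "{..m} \<inter> {m<..n} = {}"
    using le by auto
  have "(trig_partial Y Y' a m t \<omega> - trig_partial Y Y' a n t \<omega>)\<^sup>2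
      = (gsum {m<..n} (\<lambda>k. a k * sin_basis k t) (\<lambda>k. a k * cos_basis k t) \<omega>)\<^sup>2" for \<omega>
    unfolding trig_partial_eq_gsum gsum_def split(1)
    by (subst sum.union_disjoint) auto
  then have "expectation (\<lambda>\<omega>. (trig_partial Y Y' a m t \<omega> - trig_partial Y Y' a n t \<omega>)\<^sup>2)
      = (\<Sum>k\<in>{m<..n}. (a k)\<^sup>2 * cov_kernel k (t - t))"
    unfolding basis_cov_kernel[symmetric] by (simp add: power2_eq_square inner_gsum algebra_simps)
  also have "\<dots> \<le> (\<Sum>k\<in>{m<..n}. (a k)\<^sup>2 * 2)"
    by (intro sum_mono mult_left_mono) (auto simp: cov_kernel_def)
  also have "\<dots> = 2 * ((\<Sum>k\<le>n. (a k)\<^sup>2) - (\<Sum>k\<le>m. (a k)\<^sup>2))"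
    unfolding split(1) by (subst sum.union_disjoint) (auto simp: sum_distrib_left mult.commute)
  finally have "expectation (\<lambda>\<omega>. (trig_partial Y Y' a m t \<omega> - trig_partial Y Y' a n t \<omega>)\<^sup>2)
      \<le> 2 * ((\<Sum>k\<le>n. (a k)\<^sup>2) - (\<Sum>k\<le>m. (a k)\<^sup>2))" .
  moreover have "2 * (u - w) \<le> 2 * \<bar>w - u\<bar>" for u w :: real
    using abs_ge_minus_self[of "w - u"] by simp
  ultimately show ?case
    by (rule order_trans)
qed

section \<open>Processes given by the series\<close>

lemma trig_series_ms_limit:
  assumes "trig_series M Y Y' a x" "t \<in> {0..1}"
  shows "ms_limit M (\<lambda>n. trig_partial Y Y' a n t) (x t)"
  using assms
  by (auto simp: trig_series_def ms_unif_limit_def ms_limit_def dest: tendsto_uniform_limitI[where x = t])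

lemma trig_series_exists:
  assumes "a \<in> ell2"
  shows "\<exists>x. trig_series M Y Y' a x"
proof -
  define \<sigma> where "\<sigma> n = (\<Sum>k\<le>n. (a k)\<^sup>2)" for n
  obtain s where s: "\<sigma> \<longlonglongrightarrow> s"
    using assms unfolding ell2_def \<sigma>_def summable_iff_convergent' convergent_def by auto
  have "\<exists>x. ms_limit M (\<lambda>n. trig_partial Y Y' a n t) x" for t
  proof (rule ms_complete[OF square_integrable_trig_partial])
    fix e :: real assume "e > 0"
    then obtain N where N: "\<bar>\<sigma> m - \<sigma> n\<bar> < e / 2" if "m \<ge> N" "n \<ge> N" for m n
      using CauchyD[OF LIMSEQ_imp_Cauchy[OF s], of "e / 2"] by auto
    have "expectation (\<lambda>\<omega>. (trig_partial Y Y' a m t \<omega> - trig_partial Y Y' a n t \<omega>)\<^sup>2) < e"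
      if "m \<ge> N" "n \<ge> N" for m n
      using N[OF that] unfolding \<sigma>_def by (intro le_less_trans[OF trig_partial_dist_le]) simp
    then show "\<exists>N. \<forall>m\<ge>N. \<forall>n\<ge>N.
        expectation (\<lambda>\<omega>. (trig_partial Y Y' a m t \<omega> - trig_partial Y Y' a n t \<omega>)\<^sup>2) < e"
      by blast
  qed
  then obtain x where x: "ms_limit M (\<lambda>n. trig_partial Y Y' a n t) (x t)" for t
    by metis
  \<comment> \<open>Let \<open>m\<close> tend to infinity in the distance between the \<open>n\<close>th and the \<open>m\<close>th partial sum.\<close>
  have bound: "expectation (\<lambda>\<omega>. (trig_partial Y Y' a n t \<omega> - x t \<omega>)\<^sup>2) \<le> 2 * \<bar>\<sigma> n - s\<bar>" for n t
  proof (rule LIMSEQ_le)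
    have "ms_limit M (\<lambda>m \<omega>. trig_partial Y Y' a n t \<omega> - trig_partial Y Y' a m t \<omega>)
        (\<lambda>\<omega>. trig_partial Y Y' a n t \<omega> - x t \<omega>)"
      using ms_limit_lincomb[OF ms_limit_const[OF square_integrable_trig_partial] x, of 1 a n t "-1" t]
      by simp
    from ms_limit_inner[OF this this]
    show "(\<lambda>m. expectation (\<lambda>\<omega>. (trig_partial Y Y' a n t \<omega> - trig_partial Y Y' a m t \<omega>)\<^sup>2))
        \<longlonglongrightarrow> expectation (\<lambda>\<omega>. (trig_partial Y Y' a n t \<omega> - x t \<omega>)\<^sup>2)"
      by (simp add: power2_eq_square)
    show "(\<lambda>m. 2 * \<bar>\<sigma> n - \<sigma> m\<bar>) \<longlonglongrightarrow> 2 * \<bar>\<sigma> n - s\<bar>"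
      by (intro tendsto_intros s)
    show "\<exists>N. \<forall>m\<ge>N. expectation (\<lambda>\<omega>. (trig_partial Y Y' a n t \<omega> - trig_partial Y Y' a m t \<omega>)\<^sup>2)
        \<le> 2 * \<bar>\<sigma> n - \<sigma> m\<bar>"
      unfolding \<sigma>_def by (intro exI allI impI trig_partial_dist_le)
  qed
  have "uniform_limit {0..1} (\<lambda>n t. expectation (\<lambda>\<omega>. (trig_partial Y Y' a n t \<omega> - x t \<omega>)\<^sup>2)) (\<lambda>_. 0) sequentially"
  proof (rule uniform_limitI)
    fix e :: real assume "e > 0"
    have "(\<lambda>n. 2 * \<bar>\<sigma> n - s\<bar>) \<longlonglongrightarrow> 0"
      using s by (auto intro!: tendsto_eq_intros)
    from order_tendstoD(2)[OF this \<open>e > 0\<close>]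
    show "\<forall>\<^sub>F n in sequentially. \<forall>t\<in>{0..1}.
        dist (expectation (\<lambda>\<omega>. (trig_partial Y Y' a n t \<omega> - x t \<omega>)\<^sup>2)) 0 < e"
      by eventually_elim (auto intro: le_less_trans[OF bound])
  qed
  then have "trig_series M Y Y' a x"
    using x by (auto simp: trig_series_def ms_unif_limit_def ms_limit_def)
  then show ?thesis
    by blast
qed

lemma trig_series_covariance:
  assumes "trig_series M Y Y' a x" "s \<in> {0..1}" "t \<in> {0..1}"
  shows "(\<lambda>k. (a k)\<^sup>2 * cov_kernel k (s - t)) sums expectation (\<lambda>\<omega>. x s \<omega> * x t \<omega>)"
  using ms_limit_inner[OF trig_series_ms_limit[OF assms(1,2)] trig_series_ms_limit[OF assms(1,3)]]
  by (simp add: inner_trig_partial sums_def_le)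

lemma trig_series_mean:
  assumes "trig_series M Y Y' a x" "t \<in> {0..1}"
  shows "expectation (x t) = 0"
proof -
  have "(\<lambda>n. 0) \<longlonglongrightarrow> expectation (x t)"
    using ms_limit_inner[OF trig_series_ms_limit[OF assms] ms_limit_const[OF square_integrable_const[of 1]]]
    by (simp add: trig_partial_eq_gsum expectation_gsum)
  then show ?thesis
    by (simp add: LIMSEQ_const_iff)
qed

text \<open>Gaussian: a linear combination of values at finitely many times is a mean square limit of finite
  combinations of the Gaussian couple. Stationary: the covariance series converges uniformly by
  the Weierstrass test. Periodic: the partial sums agree at times \<open>0\<close> and \<open>1\<close>, and limits are
  almost surely unique.\<close>

lemma trig_series_in_procH:
  assumes a: "a \<in> ell2" and x: "trig_series M Y Y' a x"
  shows "x \<in> procH M"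
  unfolding procH_def
proof (intro CollectI conjI ballI)
  show "gaussian_process M x"
    unfolding gaussian_process_def
  proof (intro allI impI, elim conjE)
    fix T :: "real set" and c assume T: "T \<subseteq> {0..1}"
    let ?S = "\<lambda>n \<omega>. \<Sum>t\<in>T. c t * trig_partial Y Y' a n t \<omega>"
    show "gaussian_rv M (\<lambda>\<omega>. \<Sum>t\<in>T. c t * x t \<omega>)"
    proof (rule ms_limit_gaussian)
      show "ms_limit M ?S (\<lambda>\<omega>. \<Sum>t\<in>T. c t * x t \<omega>)"
        using T by (intro ms_limit_sum trig_series_ms_limit[OF x]) auto
      show "char (distr M borel (?S n)) u = of_real (exp (- (expectation (\<lambda>\<omega>. (?S n \<omega>)\<^sup>2) * u\<^sup>2) / 2))" for n u
        unfolding trig_partial_eq_gsum gsum_sum by (rule char_gsum) simp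
    qed
  qed
  show mean: "expectation (x t) = 0" if "t \<in> {0..1}" for t
    using trig_series_mean[OF x that] .
  show "\<exists>Ct. continuous_on UNIV Ct \<and> (\<forall>s\<in>{0..1}. \<forall>t\<in>{0..1}. covar M (x s) (x t) = Ct (s - t))"
  proof (intro exI conjI ballI)
    show "continuous_on UNIV (\<lambda>u. \<Sum>k. (a k)\<^sup>2 * cov_kernel k u)"
    proof (rule uniform_limit_theorem)
      show "uniform_limit UNIV (\<lambda>n u. \<Sum>k<n. (a k)\<^sup>2 * cov_kernel k u) (\<lambda>u. \<Sum>k. (a k)\<^sup>2 * cov_kernel k u) sequentially"
      proof (rule Weierstrass_m_test)
        show "summable (\<lambda>k. (a k)\<^sup>2 * 2)"
          using a by (simp add: ell2_def summable_mult2)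
        show "norm ((a k)\<^sup>2 * cov_kernel k u) \<le> (a k)\<^sup>2 * 2" for k u
          using cov_kernel_bound[of k u] by (simp add: abs_mult mult_left_mono)
      qed
      have "continuous_on UNIV (cov_kernel k)" for k
        by (cases "k = 0") (auto simp: cov_kernel_def[abs_def] intro!: continuous_intros)
      then show "\<forall>\<^sub>F n in sequentially. continuous_on UNIV (\<lambda>u. \<Sum>k<n. (a k)\<^sup>2 * cov_kernel k u)"
        by (intro always_eventually allI continuous_intros)
    qed simp
    show "covar M (x s) (x t) = (\<Sum>k. (a k)\<^sup>2 * cov_kernel k (s - t))" if "s \<in> {0..1}" "t \<in> {0..1}" for s t
      using trig_series_covariance[OF x that] mean that
      by (simp add: covar_def sums_iff)
  qed
  show "AE \<omega> in M. x 0 \<omega> = x 1 \<omega>"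
  proof (rule ms_limit_unique)
    have "trig_partial Y Y' a n 1 = trig_partial Y Y' a n 0" for n
    proof -
      have "2 * real k * pi = real (2 * k) * pi" for k
        by simp
      then have "sin (2 * real k * pi) = 0" "cos (2 * real k * pi) = 1" for k
        by (simp_all only: sin_npi cos_npi) simp
      then show ?thesis
        by (simp add: trig_partial_def fun_eq_iff)
    qed
    then show "ms_limit M (\<lambda>n. trig_partial Y Y' a n 0) (x 1)"
      using trig_series_ms_limit[OF x, of 1] by simp
  qed (use trig_series_ms_limit[OF x, of 0] in simp)
qed

lemma trig_series_in_procHZ:
  "a \<in> ell2 \<Longrightarrow> trig_series M Y Y' a x \<Longrightarrow> x \<in> procHZ M Y Y'"
  by (auto simp: procHZ_def trig_series_in_procH)

lemma trig_series_H_norm: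
  assumes a: "a \<in> ell2" and x: "trig_series M Y Y' a x"
  shows "H_norm M x = sqrt ((a 0)\<^sup>2 + 2 * (\<Sum>n. (a (Suc n))\<^sup>2))"
proof -
  define v where "v = (a 0)\<^sup>2 + 2 * (\<Sum>n. (a (Suc n))\<^sup>2)"
  have v: "expectation (\<lambda>\<omega>. x t \<omega> * x t \<omega>) = v" if "t \<in> {0..1}" for t
  proof (rule sums_unique2)
    show "(\<lambda>k. (iso_coeffs a k)\<^sup>2) sums v"
      unfolding v_def using a by (rule iso_coeffs_square_sums)
    have "(a k)\<^sup>2 * cov_kernel k (t - t) = (iso_coeffs a k)\<^sup>2" for k
      by (simp add: cov_kernel_def iso_coeffs_def power_mult_distrib)
    then show "(\<lambda>k. (iso_coeffs a k)\<^sup>2) sums expectation (\<lambda>\<omega>. x t \<omega> * x t \<omega>)"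
      using trig_series_covariance[OF x that that] by simp
  qed
  have "H_inner M x x = (LINT t:{0..1::real}|lborel. v)"
    unfolding H_inner_def by (intro set_lebesgue_integral_cong) (auto simp: v)
  also have "\<dots> = v"
    by (simp add: set_lebesgue_integral_def)
  finally show ?thesis
    by (simp add: H_norm_def v_def)
qed

lemma H_norm_ell2_norm:
  assumes "a \<in> ell2" "trig_series M Y Y' a x"
  shows "H_norm M x = ell2_norm (iso_coeffs a)"
  using trig_series_H_norm[OF assms] sums_unique[OF iso_coeffs_square_sums[OF assms(1)]]
  by (simp add: ell2_norm_def)

lemma trig_series_lincomb:
  assumes x: "trig_series M Y Y' a x" and y: "trig_series M Y Y' b y"
  shows "trig_series M Y Y' (\<lambda>k. c * a k + d * b k) (\<lambda>t \<omega>. c * x t \<omega> + d * y t \<omega>)"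
proof -
  let ?D = "\<lambda>a x n t. expectation (\<lambda>\<omega>. (trig_partial Y Y' a n t \<omega> - x t \<omega>)\<^sup>2)"
  have sq: "square_integrable M (x t)" "square_integrable M (y t)" if "t \<in> {0..1}" for t
    using x y that by (auto simp: trig_series_def ms_unif_limit_def)
  have "uniform_limit {0..1} (\<lambda>n t. 2 * c\<^sup>2 * ?D a x n t + 2 * d\<^sup>2 * ?D b y n t)
      (\<lambda>t. 2 * c\<^sup>2 * 0 + 2 * d\<^sup>2 * 0) sequentially"
    using x y by (intro uniform_limit_intros) (auto simp: trig_series_def ms_unif_limit_def)
  then have "uniform_limit {0..1} (?D (\<lambda>k. c * a k + d * b k) (\<lambda>t \<omega>. c * x t \<omega> + d * y t \<omega>)) (\<lambda>_. 0) sequentially"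
  proof (rule metric_uniform_limit_imp_uniform_limit)
    have le: "?D (\<lambda>k. c * a k + d * b k) (\<lambda>t \<omega>. c * x t \<omega> + d * y t \<omega>) n t
        \<le> 2 * c\<^sup>2 * ?D a x n t + 2 * d\<^sup>2 * ?D b y n t" if "t \<in> {0..1}" for n t
      unfolding trig_partial_lincomb
      by (rule ms_dist_lincomb_le[OF square_integrable_trig_partial sq(1)[OF that]
            square_integrable_trig_partial sq(2)[OF that]])
    show "\<forall>\<^sub>F n in sequentially. \<forall>t\<in>{0..1}.
        dist (?D (\<lambda>k. c * a k + d * b k) (\<lambda>t \<omega>. c * x t \<omega> + d * y t \<omega>) n t) 0
        \<le> dist (2 * c\<^sup>2 * ?D a x n t + 2 * d\<^sup>2 * ?D b y n t) (2 * c\<^sup>2 * 0 + 2 * d\<^sup>2 * 0)"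
    proof (intro always_eventually allI ballI)
      fix n t assume "t \<in> {0..1::real}"
      from order_trans[OF le[OF this, of n] abs_ge_self]
      show "dist (?D (\<lambda>k. c * a k + d * b k) (\<lambda>t \<omega>. c * x t \<omega> + d * y t \<omega>) n t) 0
          \<le> dist (2 * c\<^sup>2 * ?D a x n t + 2 * d\<^sup>2 * ?D b y n t) (2 * c\<^sup>2 * 0 + 2 * d\<^sup>2 * 0)"
        by (simp add: dist_real_def)
    qed
  qed
  then show ?thesis
    by (auto simp: trig_series_def ms_unif_limit_def square_integrable_trig_partial
        intro: square_integrable_lincomb sq)
qed

section \<open>The isometry\<close>

text \<open>At time \<open>0\<close> only the cosine terms survive, and pairing with \<open>Y' k\<close> extracts the \<open>k\<close>th one.\<close>

lemma trig_series_coeffs: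
  assumes x: "trig_series M Y Y' a x"
  shows "expectation (\<lambda>\<omega>. x 0 \<omega> * Y' k \<omega>) = iso_coeffs a k"
proof (rule LIMSEQ_unique)
  show "(\<lambda>n. expectation (\<lambda>\<omega>. trig_partial Y Y' a n 0 \<omega> * Y' k \<omega>)) \<longlonglongrightarrow> expectation (\<lambda>\<omega>. x 0 \<omega> * Y' k \<omega>)"
    using ms_limit_inner[OF trig_series_ms_limit[OF x, of 0] ms_limit_const[OF sq_Y']] by simp
  show "(\<lambda>n. expectation (\<lambda>\<omega>. trig_partial Y Y' a n 0 \<omega> * Y' k \<omega>)) \<longlonglongrightarrow> iso_coeffs a k"
  proof (rule tendsto_eventually)
    show "\<forall>\<^sub>F n in sequentially. expectation (\<lambda>\<omega>. trig_partial Y Y' a n 0 \<omega> * Y' k \<omega>) = iso_coeffs a k"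
      using eventually_ge_at_top[of k]
    proof eventually_elim
      case (elim n)
      \<comment> \<open>Viewed as a combination over the same index set, \<open>Y' k\<close> is accessible to \<open>inner_gsum\<close>.\<close>
      have Y': "Y' k \<omega> = gsum {..n} (\<lambda>_. 0) (\<lambda>j. if j = k then 1 else 0) \<omega>" for \<omega>
        using elim by (simp add: gsum_def if_distrib[of "\<lambda>u. u * _"] cong: if_cong)
      show ?case
      proof -
        have "expectation (\<lambda>\<omega>. trig_partial Y Y' a n 0 \<omega> * Y' k \<omega>)
            = (\<Sum>j\<le>n. a j * sin_basis j 0 * 0 + a j * cos_basis j 0 * (if j = k then 1 else 0))"
          unfolding Y' trig_partial_eq_gsum by (rule inner_gsum) simp
        also have "\<dots> = (\<Sum>j\<le>n. if j = k then a k * cos_basis k 0 else 0)"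
          by (intro sum.cong) auto
        also have "\<dots> = iso_coeffs a k"
          using elim by (simp add: iso_coeffs_def cos_basis_def)
        finally show ?thesis .
      qed
    qed
  qed
qed

text \<open>Computing the coefficients from a representative by an inner product makes the independence of
  the representative immediate: two representatives agree almost surely at time \<open>0\<close>.\<close>

definition coeff_map :: "(real \<Rightarrow> 'a \<Rightarrow> real) set \<Rightarrow> nat \<Rightarrow> real" where
  "coeff_map C n = expectation (\<lambda>\<omega>. (SOME x. x \<in> C) 0 \<omega> * Y' n \<omega>)"

lemma coeff_map_class:
  assumes "x \<in> procHZ M Y Y'" and a: "trig_series M Y Y' a x"
  shows "coeff_map (proc_eq M (procHZ M Y Y') `` {x}) = iso_coeffs a"
proof
  fix n
  define C where "C = proc_eq M (procHZ M Y Y') `` {x}"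
  have "x \<in> C"
    unfolding C_def using equiv_class_self[OF equiv_proc_eq assms(1)] .
  then have "(SOME y. y \<in> C) \<in> C"
    by (rule someI[of "\<lambda>y. y \<in> C"])
  then have z: "(x, SOME y. y \<in> C) \<in> proc_eq M (procHZ M Y Y')"
    unfolding C_def by blast
  define z where "z = (SOME y. y \<in> C)"
  have ae: "AE \<omega> in M. x 0 \<omega> = z 0 \<omega>" and "z \<in> procHZ M Y Y'"
    using z unfolding proc_eq_def z_def by auto
  then obtain b where b: "trig_series M Y Y' b z"
    by (auto simp: procHZ_def)
  have [measurable]: "x 0 \<in> borel_measurable M" "z 0 \<in> borel_measurable M"
    using a b by (auto simp: trig_series_def ms_unif_limit_def square_integrable_def)
  have "coeff_map C n = expectation (\<lambda>\<omega>. z 0 \<omega> * Y' n \<omega>)"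
    by (simp add: coeff_map_def z_def)
  also have "\<dots> = expectation (\<lambda>\<omega>. x 0 \<omega> * Y' n \<omega>)"
    using ae by (intro integral_cong_AE) auto
  also have "\<dots> = iso_coeffs a n"
    using trig_series_coeffs[OF a] .
  finally show "coeff_map (proc_eq M (procHZ M Y Y') `` {x}) n = iso_coeffs a n"
    by (simp add: C_def)
qed

lemma is_isometry_coeff_map: "is_isometry M (procHZ M Y Y') coeff_map"
proof -
  let ?A = "procHZ M Y Y'" and ?R = "proc_eq M (procHZ M Y Y')"
  have coeffs: "\<exists>a\<in>ell2. trig_series M Y Y' a x" if "x \<in> ?A" for x
    using that by (auto simp: procHZ_def)
  \<comment> \<open>With \<open>c = 1\<close> and \<open>d = -1\<close> the norm identity is the preservation of distances.\<close>
  have lincomb: "(\<lambda>t \<omega>. c * x t \<omega> + d * y t \<omega>) \<in> ?A"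
    "coeff_map (?R `` {\<lambda>t \<omega>. c * x t \<omega> + d * y t \<omega>}) = (\<lambda>n. c * coeff_map (?R `` {x}) n + d * coeff_map (?R `` {y}) n)"
    "H_norm M (\<lambda>t \<omega>. c * x t \<omega> + d * y t \<omega>) = ell2_norm (\<lambda>n. c * coeff_map (?R `` {x}) n + d * coeff_map (?R `` {y}) n)"
    if x: "x \<in> ?A" and y: "y \<in> ?A" for x y c d
  proof -
    obtain a where a: "a \<in> ell2" "trig_series M Y Y' a x"
      using coeffs[OF x] by blast
    obtain b where b: "b \<in> ell2" "trig_series M Y Y' b y"
      using coeffs[OF y] by blast
    note e = ell2_lincomb[OF a(1) b(1), of c d] and s = trig_series_lincomb[OF a(2) b(2), of c d]
    show in_A: "(\<lambda>t \<omega>. c * x t \<omega> + d * y t \<omega>) \<in> ?A"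
      using trig_series_in_procHZ[OF e s] .
    have *: "iso_coeffs (\<lambda>k. c * a k + d * b k) = (\<lambda>n. c * coeff_map (?R `` {x}) n + d * coeff_map (?R `` {y}) n)"
      by (simp add: coeff_map_class[OF x a(2)] coeff_map_class[OF y b(2)] iso_coeffs_def fun_eq_iff algebra_simps)
    show "coeff_map (?R `` {\<lambda>t \<omega>. c * x t \<omega> + d * y t \<omega>}) = (\<lambda>n. c * coeff_map (?R `` {x}) n + d * coeff_map (?R `` {y}) n)"
      using coeff_map_class[OF in_A s] * by simp
    show "H_norm M (\<lambda>t \<omega>. c * x t \<omega> + d * y t \<omega>) = ell2_norm (\<lambda>n. c * coeff_map (?R `` {x}) n + d * coeff_map (?R `` {y}) n)"
      using H_norm_ell2_norm[OF e s] * by simp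
  qed
  have "bij_betw coeff_map (?A // ?R) ell2"
    unfolding bij_betw_def
  proof
    show "inj_on coeff_map (?A // ?R)"
    proof (rule inj_onI, elim quotientE)
      fix C D x y
      assume C: "C = ?R `` {x}" "x \<in> ?A" and D: "D = ?R `` {y}" "y \<in> ?A" and eq: "coeff_map C = coeff_map D"
      obtain a where a: "trig_series M Y Y' a x"
        using coeffs[OF C(2)] by blast
      obtain b where b: "trig_series M Y Y' b y"
        using coeffs[OF D(2)] by blast
      have "a = b"
        using eq coeff_map_class[OF C(2) a] coeff_map_class[OF D(2) b] by (simp add: C D iso_coeffs_inject)
      have "AE \<omega> in M. x t \<omega> = y t \<omega>" if "t \<in> {0..1}" for t
        using trig_series_ms_limit[OF a that] trig_series_ms_limit[OF b that]
        unfolding \<open>a = b\<close> by (rule ms_limit_unique)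
      then have "(x, y) \<in> ?R"
        using C D by (simp add: proc_eq_def)
      then show "C = D"
        using equiv_class_eq[OF equiv_proc_eq] C D by blast
    qed
    show "coeff_map ` (?A // ?R) = ell2"
    proof (intro equalityI subsetI)
      fix b assume "b \<in> coeff_map ` (?A // ?R)"
      then obtain x where x: "x \<in> ?A" "b = coeff_map (?R `` {x})"
        by (auto elim!: quotientE)
      obtain a where a: "a \<in> ell2" "trig_series M Y Y' a x"
        using coeffs[OF x(1)] by blast
      show "b \<in> ell2"
        using sums_summable[OF iso_coeffs_square_sums[OF a(1)]] coeff_map_class[OF x(1) a(2)] x(2)
        by (simp add: ell2_def)
    next
      fix b :: "nat \<Rightarrow> real" assume "b \<in> ell2"
      then obtain a where a: "a \<in> ell2" "iso_coeffs a = b"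
        by (rule iso_coeffs_surj)
      obtain x where s: "trig_series M Y Y' a x"
        using trig_series_exists[OF a(1)] by blast
      have x: "x \<in> ?A"
        using trig_series_in_procHZ[OF a(1) s] .
      then have "b = coeff_map (?R `` {x})"
        using coeff_map_class[OF x s] a by simp
      then show "b \<in> coeff_map ` (?A // ?R)"
        using quotientI[OF x] by blast
    qed
  qed
  moreover have "H_norm M (\<lambda>t \<omega>. x t \<omega> - y t \<omega>) = ell2_norm (\<lambda>n. coeff_map (?R `` {x}) n - coeff_map (?R `` {y}) n)"
    if "x \<in> ?A" "y \<in> ?A" for x y
    using lincomb(3)[OF that, of 1 "-1"] by simp
  ultimately show ?thesis
    unfolding is_isometry_def using equiv_proc_eq lincomb(1,2) by blast
qed

end

theorem mainTheorem3:
  fixes M :: "'a measure" and Y Y' :: "nat \<Rightarrow> 'a \<Rightarrow> real"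
  assumes "prob_space M"
    and "gaussian_couple M Y Y'"
  shows "(\<forall>a\<in>ell2.
            (\<exists>x. trig_series M Y Y' a x) \<and>
            (\<forall>x. trig_series M Y Y' a x \<longrightarrow>
               x \<in> procHZ M Y Y' \<and>
               H_norm M x = sqrt ((a 0)\<^sup>2 + 2 * (\<Sum>n. (a (Suc n))\<^sup>2)))) \<and>
         (\<exists>\<Phi>. is_isometry M (procHZ M Y Y') \<Phi> \<and>
            (\<forall>x\<in>procHZ M Y Y'. \<forall>a\<in>ell2. trig_series M Y Y' a x \<longrightarrow>
               \<Phi> (proc_eq M (procHZ M Y Y') `` {x}) = iso_coeffs a))"
proof -
  interpret prob_space M
    by fact
  interpret gaussian_pair M Y Y'
    by unfold_locales fact
  show ?thesis
    using trig_series_exists trig_series_in_procHZ trig_series_H_norm is_isometry_coeff_map coeff_map_class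
    by blast
qed

end
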